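(* For $k\ge 2$, the competitive ratio of any online algorithm for $\mathtt{SMkM}$ against an oblivious adversary is at least $\frac{k}{81\ln k}$. This holds even when the task is to find a maximum size common independent set in $k$ partition matroids (i.e. $f(S)=|S|$), and the common rank of these matroids is $O(k/\log k)$.
   Context: $\mathtt{SMkM}$ (Submodular Maximization subject to $k$ Matroid Constraints): given $k\ge 2$ matroids $M_1=(\mathcal N,\mathcal I_1),\dots,M_k=(\mathcal N,\mathcal I_k)$ on a common ground set $\mathcal N$ and a non-negative submodular function $f:2^{\mathcal N}\to\mathbb R_{\ge0}$, find a common independent set $S$ (independent in all $k$ matroids) maximizing $f(S)$. The common rank is the maximum cardinality of a common independent set. (Preemptive) online model: the elements of the ground set arrive one by one. Upon receiving an element, the (possibly randomized) algorithm must either add it to the solution it maintains or reject it. An accepted element may be removed from the solution at a later point, but a rejection or removal is irrevocable. The maintained solution must be a common independent set at all times. The algorithm may have full access to the matroids over a "super ground set" known upfront, of which only some elements arrive. The competitive ratio against an oblivious adversary is the smallest $c$ such that, on every instance and arrival order fixed in advance, the expected value of the final solution is at least $1/c$ times the optimal value. *)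

theory Defs
  imports "HOL-Probability.Probability" "HOL-Library.Landau_Symbols" "HOL-Library.Disjoint_Sets"
begin

definition matroid :: "'a set \<Rightarrow> 'a set set \<Rightarrow> bool" where
  "matroid U I \<longleftrightarrow>
     finite U \<and> I \<subseteq> Pow U \<and> {} \<in> I \<and>
     (\<forall>S\<in>I. \<forall>T. T \<subseteq> S \<longrightarrow> T \<in> I) \<and>
     (\<forall>S\<in>I. \<forall>T\<in>I. card S < card T \<longrightarrow> (\<exists>x\<in>T - S. insert x S \<in> I))"

definition partition_matroid :: "'a set \<Rightarrow> 'a set set \<Rightarrow> bool" where
  "partition_matroid U I \<longleftrightarrow>
     finite U \<and>
     (\<exists>P (b :: 'a set \<Rightarrow> nat). partition_on U P \<and>
        I = {S. S \<subseteq> U \<and> (\<forall>X\<in>P. card (S \<inter> X) \<le> b X)})"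

definition submodular_on :: "'a set \<Rightarrow> ('a set \<Rightarrow> real) \<Rightarrow> bool" where
  "submodular_on N f \<longleftrightarrow>
     (\<forall>S T. S \<subseteq> N \<longrightarrow> T \<subseteq> N \<longrightarrow> f (S \<union> T) + f (S \<inter> T) \<le> f S + f T)"

definition common_indep :: "'a set set list \<Rightarrow> 'a set \<Rightarrow> bool" where
  "common_indep Is S \<longleftrightarrow> (\<forall>I\<in>set Is. S \<in> I)"

definition common_rank :: "'a set \<Rightarrow> 'a set set list \<Rightarrow> nat" where
  "common_rank U Is = Max (card ` {S. S \<subseteq> U \<and> common_indep Is S})"

text \<open>
  An online instance consists of a super ground set \<open>U\<close>, the list \<open>Is\<close> of the independence
  systems of the matroids on \<open>U\<close>, an objective function \<open>f\<close> and the list \<open>xs\<close> of the arriving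
  elements in their order of arrival. The ground set of the offline problem is \<open>set xs\<close>.
\<close>

type_synonym 'a inst_class =
  "'a set \<Rightarrow> 'a set set list \<Rightarrow> ('a set \<Rightarrow> real) \<Rightarrow> 'a list \<Rightarrow> bool"

definition smkm_instance :: "nat \<Rightarrow> 'a inst_class" where
  "smkm_instance k U Is f xs \<longleftrightarrow>
     length Is = k \<and> (\<forall>I\<in>set Is. matroid U I) \<and>
     distinct xs \<and> set xs \<subseteq> U \<and>
     (\<forall>S. S \<subseteq> set xs \<longrightarrow> 0 \<le> f S) \<and> submodular_on (set xs) f"

definition card_partition_instance :: "nat \<Rightarrow> nat \<Rightarrow> 'a inst_class" where
  "card_partition_instance k r U Is f xs \<longleftrightarrow>
     smkm_instance k U Is f xs \<and>
     (\<forall>I\<in>set Is. partition_matroid U I) \<and>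
     (\<forall>S. S \<subseteq> set xs \<longrightarrow> f S = real (card S)) \<and>
     common_rank U Is \<le> r"

definition opt_value :: "'a set set list \<Rightarrow> ('a set \<Rightarrow> real) \<Rightarrow> 'a list \<Rightarrow> real" where
  "opt_value Is f xs = Max (f ` {S. S \<subseteq> set xs \<and> common_indep Is S})"

text \<open>
  A deterministic online algorithm maps the data known upfront (\<open>U\<close> and \<open>Is\<close>), the objective
  function and the sequence of elements that have arrived so far to the solution maintained at
  that time. The last condition below says that the objective function is accessible only on
  sets of elements that have already arrived. As arriving elements are distinct, the inclusion
  in \<open>insert\<close> makes rejections and removals irrevocable.
\<close>

type_synonym 'a online_alg =
  "'a set \<Rightarrow> 'a set set list \<Rightarrow> ('a set \<Rightarrow> real) \<Rightarrow> 'a list \<Rightarrow> 'a set"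

definition online_algorithm :: "'a inst_class \<Rightarrow> 'a online_alg \<Rightarrow> bool" where
  "online_algorithm C A \<longleftrightarrow>
     (\<forall>U Is f xs. C U Is f xs \<longrightarrow>
        A U Is f [] = {} \<and>
        (\<forall>n<length xs. A U Is f (take (Suc n) xs) \<subseteq> insert (xs ! n) (A U Is f (take n xs))) \<and>
        (\<forall>n\<le>length xs. common_indep Is (A U Is f (take n xs)))) \<and>
     (\<forall>U Is f g xs. (\<forall>S. S \<subseteq> set xs \<longrightarrow> f S = g S) \<longrightarrow> A U Is f xs = A U Is g xs)"

text \<open>
  A randomized online algorithm is a probability distribution over deterministic ones, such
  that on every instance of the class its output is a random variable.
\<close>

definition randomized_online_algorithm ::
    "'a inst_class \<Rightarrow> 'a online_alg measure \<Rightarrow> bool" where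
  "randomized_online_algorithm C M \<longleftrightarrow>
     prob_space M \<and>
     (\<forall>A\<in>space M. online_algorithm C A) \<and>
     (\<forall>U Is f xs. C U Is f xs \<longrightarrow> (\<lambda>A. A U Is f xs) \<in> measurable M (count_space UNIV))"

definition competitive ::
    "'a inst_class \<Rightarrow> 'a online_alg measure \<Rightarrow> real \<Rightarrow> bool" where
  "competitive C M c \<longleftrightarrow>
     (\<forall>U Is f xs. C U Is f xs \<longrightarrow>
        (1 / c) * opt_value Is f xs \<le> (\<integral>A. f (A U Is f xs) \<partial>M))"

text \<open>
  The instance, including the arrival order, is fixed before the randomness of the algorithm is
  drawn, so the adversary is oblivious. The ratio is infinite if no \<open>c\<close> works. The condition
  \<open>c > 0\<close> is needed since \<open>1 / 0 = 0\<close>.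
\<close>

definition competitive_ratio ::
    "'a inst_class \<Rightarrow> 'a online_alg measure \<Rightarrow> ereal" where
  "competitive_ratio C M = Inf {ereal c | c. c > 0 \<and> competitive C M c}"

end

theory Submission
  imports Defs "HOL-Library.Nat_Bijection"
begin

text \<open>
  The super ground set consists of the nonempty words of length at most \<open>T\<close> over \<open>n = 2 ^ s \<ge> T\<close>
  letters, that is, of the nodes of an \<open>n\<close>-ary tree. The adversary draws a hidden word \<open>w\<close>
  uniformly and presents, level by level, all children of the nodes on the path of \<open>w\<close>. The
  matroids make this path, of size \<open>T\<close>, independent, whereas an arriving node off the path is in
  conflict with its siblings and with everything that arrives on later levels. The algorithm
  hence keeps at most one node off the path, and hits the path with probability at most \<open>1 / n\<close>
  on each level, so that it ends with at most \<open>1 + T / n \<le> 2\<close> elements on average. Splitting the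
  conflicts by the sum of the two levels and by a bit in which the two sibling letters differ
  realizes them by \<open>4 T s + 1\<close> partition matroids, so \<open>s = \<lceil>log\<^sub>2 k\<rceil>\<close> allows
  \<open>T \<approx> k / (4 log\<^sub>2 k)\<close>. If \<open>k / (81 ln k) \<le> 1\<close>, a single element suffices.
\<close>

declare list_encode_eq [simp]

section \<open>Partition matroids given by keys\<close>

definition key_indep :: "'a set \<Rightarrow> ('a \<Rightarrow> 'b) \<Rightarrow> 'a set set" where
  "key_indep U g = {S. S \<subseteq> U \<and> inj_on g S}"

text \<open>A larger independent set shows more keys, so one of its elements has a key new to the
  smaller set.\<close>

lemma matroid_key_indep:
  assumes "finite U"
  shows "matroid U (key_indep U g)"
proof -
  have "\<exists>x\<in>T - S. insert x S \<in> key_indep U g"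
    if S: "S \<in> key_indep U g" and T: "T \<in> key_indep U g" and less: "card S < card T" for S T
  proof -
    have fin: "finite S" "finite T" and inj: "inj_on g S" "inj_on g T"
      using S T assms by (auto simp: key_indep_def intro: finite_subset)
    have "card (g ` S) < card (g ` T)"
      using inj less by (simp add: card_image)
    then have "\<not> g ` T \<subseteq> g ` S"
      using card_mono[of "g ` S" "g ` T"] fin by auto
    then obtain x where x: "x \<in> T" "g x \<notin> g ` S"
      by auto
    then have "insert x S \<in> key_indep U g" "x \<notin> S"
      using S T by (auto simp: key_indep_def)
    with x show ?thesis
      by blast
  qed
  then show ?thesis
    using assms by (auto simp: matroid_def key_indep_def intro: inj_on_subset)
qed

text \<open>The parts are the fibres of \<open>g\<close> on \<open>U\<close>, each with capacity
  1.\<close>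

lemma partition_matroid_key_indep:
  assumes "finite U"
  shows "partition_matroid U (key_indep U g)"
proof -
  define P where "P = (\<lambda>x. {y \<in> U. g y = g x}) ` U"
  have part: "partition_on U P"
    by (rule partition_onI) (auto simp: P_def disjnt_def)
  have "inj_on g S \<longleftrightarrow> (\<forall>X\<in>P. card (S \<inter> X) \<le> 1)" if S: "S \<subseteq> U" for S
  proof -
    have fin: "finite (S \<inter> X)" for X
      using S assms by (auto intro: finite_subset)
    have "inj_on g S \<longleftrightarrow> (\<forall>X\<in>P. \<forall>x\<in>S \<inter> X. \<forall>y\<in>S \<inter> X. x = y)"
      using S by (fastforce simp: P_def inj_on_def)
    also have "\<dots> \<longleftrightarrow> (\<forall>X\<in>P. card (S \<inter> X) \<le> 1)"
      using fin by (auto simp: card_le_Suc0_iff_eq)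
    finally show ?thesis .
  qed
  then have "key_indep U g = {S. S \<subseteq> U \<and> (\<forall>X\<in>P. card (S \<inter> X) \<le> 1)}"
    by (auto simp: key_indep_def)
  with part assms show ?thesis
    unfolding partition_matroid_def by (intro conjI exI[of _ P] exI[of _ "\<lambda>_. 1"])
qed

section \<open>Sibling conflicts expressed as keys\<close>

text \<open>
  Under \<open>sibling_key c t v\<close>, a word of length \<open>m\<close> is paired only with words of length \<open>c - m\<close>.
  Thus the \<open>O(T)\<close> values of \<open>c\<close> serve all pairs of lengths, and a part never contains a word
  together with a proper prefix: the two would disagree on bit \<open>t\<close> of a common letter.
\<close>

definition sibling_key :: "nat \<Rightarrow> nat \<Rightarrow> bool \<Rightarrow> nat list \<Rightarrow> nat \<times> nat list" where
  "sibling_key c t v z =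
     (let m = min (length z) (c - length z) in
      if 0 < m \<and> (bit (z ! (m - 1)) t = v) = (length z = m) then (m, take (m - 1) z) else (0, z))"

text \<open>This is what keeps the hidden path independent. Equal keys of distinct prefixes cannot
  have first component 0, so both lengths share a positive minimum \<open>m\<close>. Both tests read
  the same letter of \<open>w\<close>, hence agree on whether the length is \<open>m\<close>. But
  distinct lengths with this minimum are \<open>m\<close> and \<open>c - m\<close>, and only one of
  them is \<open>m\<close>.\<close>

lemma sibling_key_prefixes:
  assumes "sibling_key c t v (take i w) = sibling_key c t v (take j w)"
    and "i \<le> length w" and "j \<le> length w"
  shows "take i w = take j w"
proof (rule ccontr)
  assume ne: "take i w \<noteq> take j w"
  define m where "m l = min l (c - l)" for l
  have key: "sibling_key c t v (take l w) =
    (if 0 < m l \<and> (bit (w ! (m l - 1)) t = v) = (l = m l)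
     then (m l, take (m l - 1) w) else (0, take l w))" if "l \<le> length w" for l
  proof -
    have "length (take l w) = l"
      using that by simp
    moreover have "take l w ! (m l - 1) = w ! (m l - 1)" if "0 < m l"
      using that by (intro nth_take) (auto simp: m_def)
    moreover have "take (m l - 1) (take l w) = take (m l - 1) w"
      by (simp add: m_def min_def)
    ultimately show ?thesis
      by (auto simp: sibling_key_def m_def[of l, symmetric] Let_def)
  qed
  have "m i = m j" "0 < m i" "(i = m i) = (j = m j)" "i \<noteq> j"
    using assms(1) ne key[OF assms(2)] key[OF assms(3)] by (auto split: if_splits)
  then show False
    by (auto simp: m_def min_def split: if_splits)
qed

text \<open>Here \<open>m\<close> is the length of \<open>p @ [a]\<close>. The first word matches
  the bit and has length \<open>m\<close>; the second fails both tests, being longer by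
  \<open>u \<noteq> []\<close>. So both get the key \<open>(m, p)\<close>.\<close>

lemma sibling_key_eq:
  assumes "bit a t \<noteq> bit b t" and "u \<noteq> []"
  shows "sibling_key (length (p @ [a]) + length (p @ b # u)) t (bit a t) (p @ [a]) =
         sibling_key (length (p @ [a]) + length (p @ b # u)) t (bit a t) (p @ b # u)"
  using assms by (auto simp: sibling_key_def Let_def min_def nth_append)

lemma ex_bit_neq:
  fixes a b :: nat
  assumes "a < 2 ^ s" and "b < 2 ^ s" and "a \<noteq> b"
  obtains t where "t < s" and "bit a t \<noteq> bit b t"
proof -
  obtain t where t: "bit a t \<noteq> bit b t"
    using assms(3) bit_eq_iff by blast
  have "take_bit s a = a" "take_bit s b = b"
    using assms by (auto simp: take_bit_nat_eq_self)
  with t have "t < s"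
    by (metis bit_take_bit_iff)
  with t that show thesis
    by blast
qed

section \<open>The instance\<close>

text \<open>Two distinct lengths up to \<open>T\<close> add up to less than \<open>2 * T\<close>,
  which bounds \<open>c\<close>. With \<open>s\<close> bits and two values of \<open>v\<close> this
  makes \<open>4 * T * s\<close> keys.\<close>

definition keys :: "nat \<Rightarrow> nat \<Rightarrow> (nat list \<Rightarrow> nat \<times> nat list) list" where
  "keys T s =
     concat (map (\<lambda>c. concat (map (\<lambda>t. map (sibling_key c t) [True, False]) [0..<s])) [0..<2 * T])"

text \<open>The theorem fixes \<open>nat\<close> as the type of elements, so words are coded by
  \<open>list_encode\<close>.\<close>

definition universe :: "nat \<Rightarrow> nat \<Rightarrow> nat set" where
  "universe T s = list_encode ` {z. set z \<subseteq> {..<2 ^ s} \<and> length z \<le> T \<and> z \<noteq> []}"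

text \<open>The copies of the length key bound the common rank by \<open>T\<close> and pad the list to length \<open>k\<close>.\<close>

definition matroids :: "nat \<Rightarrow> nat \<Rightarrow> nat \<Rightarrow> nat set set list" where
  "matroids k T s = map (\<lambda>g. key_indep (universe T s) (g \<circ> list_decode))
     (keys T s @ replicate (k - 4 * T * s) (\<lambda>z. (length z, [])))"

definition words :: "nat \<Rightarrow> nat \<Rightarrow> nat list set" where
  "words T s = {w. set w \<subseteq> {..<2 ^ s} \<and> length w = T}"

definition stage :: "nat \<Rightarrow> nat list \<Rightarrow> nat \<Rightarrow> nat list" where
  "stage s w i = map (\<lambda>a. list_encode (take i w @ [a])) [0..<2 ^ s]"

definition arrivals :: "nat \<Rightarrow> nat list \<Rightarrow> nat \<Rightarrow> nat list" where
  "arrivals s w i = concat (map (stage s w) [0..<i])"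

definition hidden_path :: "nat list \<Rightarrow> nat set" where
  "hidden_path w = (\<lambda>i. list_encode (take (Suc i) w)) ` {..<length w}"

lemma finite_universe: "finite (universe T s)"
proof -
  have "finite {z. set z \<subseteq> {..<2 ^ s :: nat} \<and> length z \<le> T}"
    by (rule finite_lists_length_le) simp
  then show ?thesis
    unfolding universe_def by (rule finite_imageI[OF finite_subset[rotated]]) auto
qed

lemma finite_words: "finite (words T s)"
  unfolding words_def by (rule finite_lists_length_eq) simp

lemma card_words: "card (words T s) = (2 ^ s) ^ T"
  unfolding words_def by (simp add: card_lists_length_eq)

lemma length_keys: "length (keys T s) = 4 * T * s"
  by (simp add: keys_def length_concat comp_def sum_list_triv)

lemma set_keys: "set (keys T s) = (\<Union>c<2 * T. \<Union>t<s. range (sibling_key c t))"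
  by (simp add: keys_def UNIV_bool insert_commute lessThan_atLeast0)

lemma length_matroids: "4 * T * s < k \<Longrightarrow> length (matroids k T s) = k"
  by (simp add: matroids_def length_keys)

section \<open>Common independent sets\<close>

text \<open>The strict inequality leaves room for at least one copy of the length key, so the length
  condition is indeed imposed.\<close>

lemma common_indep_matroids:
  assumes "4 * T * s < k"
  shows "common_indep (matroids k T s) S \<longleftrightarrow>
    S \<subseteq> universe T s \<and> inj_on (length \<circ> list_decode) S \<and>
    (\<forall>c<2 * T. \<forall>t<s. \<forall>v. inj_on (sibling_key c t v \<circ> list_decode) S)"
proof -
  have "common_indep (matroids k T s) S \<longleftrightarrow>
    (\<forall>g \<in> insert (\<lambda>z. (length z, [])) (set (keys T s)).
      S \<subseteq> universe T s \<and> inj_on (g \<circ> list_decode) S)"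
    using assms by (auto simp: common_indep_def matroids_def key_indep_def)
  moreover have "inj_on ((\<lambda>z. (length z, [])) \<circ> list_decode) S = inj_on (length \<circ> list_decode) S"
    by (auto simp: inj_on_def)
  ultimately show ?thesis
    by (auto simp: set_keys)
qed

text \<open>Words in a common independent set have distinct lengths between 1 and
  \<open>T\<close>.\<close>

lemma common_rank_matroids:
  assumes "4 * T * s < k"
  shows "common_rank (universe T s) (matroids k T s) \<le> T"
proof -
  let ?F = "{S. S \<subseteq> universe T s \<and> common_indep (matroids k T s) S}"
  have "card S \<le> T" if "S \<in> ?F" for S
  proof -
    have "(length \<circ> list_decode) ` S \<subseteq> {1..T}"
      using that by (fastforce simp: universe_def Suc_le_eq)
    moreover have "inj_on (length \<circ> list_decode) S"
      using that common_indep_matroids[OF assms] by blast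
    ultimately show ?thesis
      using card_inj_on_le[of "length \<circ> list_decode" S "{1..T}"] by simp
  qed
  moreover have "{} \<in> ?F"
    using common_indep_matroids[OF assms] by simp
  moreover have "finite ?F"
    using finite_universe by (rule finite_subset[rotated, OF finite_Pow_iff[THEN iffD2]]) auto
  ultimately show ?thesis
    unfolding common_rank_def by (subst Max_le_iff) auto
qed

text \<open>Distinct siblings clash under the length key. A longer word through another child
  clashes under the sibling key for the sum of the two lengths and a bit in which \<open>a\<close>
  and \<open>b\<close> differ.\<close>

lemma common_indep_siblings:
  assumes k: "4 * T * s < k" and indep: "common_indep (matroids k T s) S"
    and x: "list_encode (p @ [a]) \<in> S" and y: "list_encode (p @ b # u) \<in> S"
  shows "a = b"
proof (rule ccontr)
  assume ne: "a \<noteq> b"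
  note S = indep[unfolded common_indep_matroids[OF k]]
  have U: "list_encode (p @ [a]) \<in> universe T s" "list_encode (p @ b # u) \<in> universe T s"
    using S x y by auto
  have bound: "a < 2 ^ s" "b < 2 ^ s" "length (p @ [a]) \<le> T" "length (p @ b # u) \<le> T"
    using U by (auto simp: universe_def inj_image_mem_iff)
  show False
  proof (cases "u = []")
    case True
    have "inj_on (length \<circ> list_decode) S"
      using S by blast
    then have "list_encode (p @ [a]) = list_encode (p @ b # u)"
      by (rule inj_onD) (use x y True in auto)
    with ne show False
      by simp
  next
    case False
    obtain t where t: "t < s" "bit a t \<noteq> bit b t"
      using ex_bit_neq bound ne by metis
    define c where "c = length (p @ [a]) + length (p @ b # u)"
    have "c < 2 * T"
      using bound False unfolding c_def by (cases u) auto
    then have "inj_on (sibling_key c t (bit a t) \<circ> list_decode) S"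
      using S t by blast
    then have "list_encode (p @ [a]) = list_encode (p @ b # u)"
      by (rule inj_onD) (use x y sibling_key_eq[OF t(2) False, of p] in \<open>auto simp: c_def\<close>)
    with ne show False
      by simp
  qed
qed

lemma common_indep_hidden_path:
  assumes k: "4 * T * s < k" and w: "w \<in> words T s"
  shows "common_indep (matroids k T s) (hidden_path w)"
  unfolding common_indep_matroids[OF k]
proof (intro conjI allI impI)
  show "hidden_path w \<subseteq> universe T s"
    using w by (fastforce simp: hidden_path_def universe_def words_def dest: in_set_takeD)
  show "inj_on (length \<circ> list_decode) (hidden_path w)"
    by (auto simp: hidden_path_def inj_on_def)
  show "inj_on (sibling_key c t v \<circ> list_decode) (hidden_path w)" for c t v
    by (auto simp: hidden_path_def inj_on_def Suc_le_eq dest!: sibling_key_prefixes)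
qed

lemma card_hidden_path: "card (hidden_path w) = length w"
proof -
  have "inj_on (\<lambda>i. list_encode (take (Suc i) w)) {..<length w}"
    by (rule inj_on_inverseI[of _ "\<lambda>z. length (list_decode z) - 1"]) simp
  then show ?thesis
    by (simp add: hidden_path_def card_image)
qed

section \<open>The arrival order\<close>

lemma arrivals_Suc: "arrivals s w (Suc i) = arrivals s w i @ stage s w i"
  by (simp add: arrivals_def)

lemma set_arrivals:
  "set (arrivals s w i) = {list_encode (take j w @ [a]) | j a. j < i \<and> a < 2 ^ s}"
  by (auto simp: arrivals_def stage_def)

lemma distinct_arrivals: "i \<le> length w \<Longrightarrow> distinct (arrivals s w i)"
proof (induction i)
  case 0
  then show ?case
    by (simp add: arrivals_def)
next
  case (Suc i)
  have "distinct (stage s w i)"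
    by (simp add: stage_def distinct_map inj_on_def)
  moreover have "z \<notin> set (stage s w i)" if z: "z \<in> set (arrivals s w i)" for z
  proof
    assume "z \<in> set (stage s w i)"
    then obtain a where a: "z = list_encode (take i w @ [a])"
      by (auto simp: stage_def)
    obtain j b where "j < i" "z = list_encode (take j w @ [b])"
      using z by (auto simp: set_arrivals)
    then have "length (take i w) = length (take j w)"
      using a by simp
    with \<open>j < i\<close> Suc.prems show False
      by simp
  qed
  ultimately show ?case
    using Suc by (auto simp: arrivals_Suc)
qed

lemma arrivals_eq_append:
  assumes "i \<le> j"
  shows "arrivals s w j = arrivals s w i @ concat (map (stage s w) [i..<j])"
  using assms upt_add_eq_append[of 0 i "j - i"] by (simp add: arrivals_def)

text \<open>Stage \<open>i\<close> lists all children of \<open>take i w\<close> and so reveals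
  nothing about \<open>w ! i\<close>. The algorithm chooses among these children while that letter
  is still open.\<close>

lemma arrivals_cong:
  assumes "take i w = take i w'"
  shows "arrivals s w (Suc i) = arrivals s w' (Suc i)"
proof -
  have "take j w = take j w'" if "j \<le> i" for j
    using that assms by (metis min.absorb1 take_take)
  then have "map (stage s w) [0..<Suc i] = map (stage s w') [0..<Suc i]"
    by (intro map_cong refl) (auto simp: stage_def)
  then show ?thesis
    unfolding arrivals_def by (rule arg_cong)
qed

lemma set_arrivals_subset_universe:
  assumes "w \<in> words T s"
  shows "set (arrivals s w T) \<subseteq> universe T s"
  using assms by (fastforce simp: set_arrivals universe_def words_def dest: in_set_takeD)

lemma hidden_path_subset_arrivals:
  assumes "w \<in> words T s"
  shows "hidden_path w \<subseteq> set (arrivals s w T)"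
proof
  fix z assume "z \<in> hidden_path w"
  then obtain i where i: "i < T" "z = list_encode (take (Suc i) w)"
    using assms by (auto simp: hidden_path_def words_def)
  then have "z = list_encode (take i w @ [w ! i])" "w ! i < 2 ^ s"
    using assms by (auto simp: words_def take_Suc_conv_app_nth subset_iff)
  with i(1) show "z \<in> set (arrivals s w T)"
    unfolding set_arrivals by blast
qed

lemma arrivals_instance:
  assumes "4 * T * s < k" and "T \<le> r" and w: "w \<in> words T s"
  shows "card_partition_instance k r (universe T s) (matroids k T s) (\<lambda>S. real (card S))
           (arrivals s w T)"
proof -
  have "submodular_on (set (arrivals s w T)) (\<lambda>S. real (card S))"
    unfolding submodular_on_def
    by (metis List.finite_set card_Un_Int finite_subset of_nat_add order_refl)
  moreover have "matroid (universe T s) I \<and> partition_matroid (universe T s) I"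
    if "I \<in> set (matroids k T s)" for I
    using that matroid_key_indep[OF finite_universe] partition_matroid_key_indep[OF finite_universe]
    by (auto simp: matroids_def)
  ultimately show ?thesis
    using assms length_matroids[OF assms(1)] common_rank_matroids[OF assms(1)]
      set_arrivals_subset_universe[OF w] distinct_arrivals[of T w s]
    by (auto simp: card_partition_instance_def smkm_instance_def words_def)
qed

lemma opt_value_arrivals:
  assumes "4 * T * s < k" and w: "w \<in> words T s"
  shows "real T \<le> opt_value (matroids k T s) (\<lambda>S. real (card S)) (arrivals s w T)"
proof -
  have "real (card (hidden_path w)) \<le> opt_value (matroids k T s) (\<lambda>S. real (card S)) (arrivals s w T)"
    unfolding opt_value_def
    using common_indep_hidden_path[OF assms] hidden_path_subset_arrivals[OF w] by (intro Max_ge) auto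
  then show ?thesis
    using w by (simp add: card_hidden_path words_def)
qed

section \<open>Solutions of a deterministic algorithm, averaged over the hidden word\<close>

text \<open>Used with \<open>ys\<close> the arrivals up to some stage: an element of that stage in
  the final solution was held at the end of the stage, since it does not arrive again.\<close>

lemma online_subset:
  assumes "\<forall>n<length xs. B (take (Suc n) xs) \<subseteq> insert (xs ! n) (B (take n xs))"
    and "xs = ys @ zs"
  shows "B xs \<subseteq> B ys \<union> set zs"
  using assms
proof (induction zs arbitrary: xs rule: rev_induct)
  case (snoc z zs)
  have step: "B (take (Suc n) (ys @ zs)) \<subseteq> insert ((ys @ zs) ! n) (B (take n (ys @ zs)))"
    if "n < length (ys @ zs)" for n
  proof -
    have "xs = (ys @ zs) @ [z]"
      using snoc.prems(2) by simp
    then show ?thesis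
      using snoc.prems(1)[rule_format, of n] that
      by (simp add: nth_append del: append_assoc split: if_splits)
  qed
  then have "B (ys @ zs) \<subseteq> B ys \<union> set zs"
    by (intro snoc.IH) auto
  moreover have "B xs \<subseteq> insert z (B (ys @ zs))"
    using snoc.prems(1)[rule_format, of "length (ys @ zs)"] snoc.prems(2)
    by (simp add: nth_append)
  ultimately show ?case
    by auto
qed simp

text \<open>Overwriting letter \<open>i\<close> of a hit word by any of the \<open>2 ^ s\<close>
  letters loses nothing: the result still shows \<open>take i w\<close>, which determines
  \<open>D w\<close> and hence its only element, the overwritten letter.\<close>

lemma card_words_hit:
  assumes "i < T"
    and cong: "\<And>w w'. w \<in> words T s \<Longrightarrow> w' \<in> words T s \<Longrightarrow> take i w = take i w' \<Longrightarrow> D w = D w'"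
    and single: "\<And>w a b. w \<in> words T s \<Longrightarrow> a \<in> D w \<Longrightarrow> b \<in> D w \<Longrightarrow> a = b"
  shows "card {w \<in> words T s. w ! i \<in> D w} * 2 ^ s \<le> (2 ^ s) ^ T"
proof -
  let ?H = "{w \<in> words T s. w ! i \<in> D w}"
  let ?h = "\<lambda>(w, a). w[i := a]"
  have "inj_on ?h (?H \<times> {..<2 ^ s :: nat})"
  proof (rule inj_onI, clarify)
    fix w a w' a'
    assume w: "w \<in> words T s" "w ! i \<in> D w" and w': "w' \<in> words T s" "w' ! i \<in> D w'"
      and eq: "w[i := a] = w'[i := a']"
    have len: "length w = T" "length w' = T"
      using w w' by (auto simp: words_def)
    have nth: "w ! j = w' ! j" if "j \<noteq> i" for j
      using arg_cong[OF eq, of "\<lambda>u. u ! j"] that by simp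
    have "take i w = take i w'"
      using len \<open>i < T\<close> nth by (intro nth_equalityI) auto
    then have "w ! i = w' ! i"
      using cong single w w' by metis
    with nth have "w ! j = w' ! j" for j
      by (cases "j = i") auto
    then have "w = w'"
      using len by (intro nth_equalityI) auto
    moreover have "a = a'"
      using arg_cong[OF eq, of "\<lambda>u. u ! i"] len \<open>i < T\<close> by simp
    ultimately show "w = w' \<and> a = a'"
      by simp
  qed
  moreover have "?h ` (?H \<times> {..<2 ^ s}) \<subseteq> words T s"
    using set_update_subset_insert by (fastforce simp: words_def)
  ultimately have "card (?H \<times> {..<2 ^ s :: nat}) \<le> card (words T s)"
    using finite_words by (rule card_inj_on_le)
  then show ?thesis
    by (simp add: card_words card_cartesian_product)
qed

text \<open>
  At most one element of the final solution lies off the hidden path. An element of the hidden path can only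
  be kept if it is the one child retained at the end of its stage, and up to that moment all
  \<open>2 ^ s\<close> children are equally likely to be on the hidden path.
\<close>

lemma sum_card_solutions:
  assumes k: "4 * T * s < k" and T: "T \<le> 2 ^ s"
    and step: "\<And>w n. w \<in> words T s \<Longrightarrow> n < length (arrivals s w T) \<Longrightarrow>
      B (take (Suc n) (arrivals s w T)) \<subseteq>
        insert (arrivals s w T ! n) (B (take n (arrivals s w T)))"
    and empty: "B [] = {}"
    and indep: "\<And>w n. w \<in> words T s \<Longrightarrow> n \<le> length (arrivals s w T) \<Longrightarrow>
      common_indep (matroids k T s) (B (take n (arrivals s w T)))"
  shows "(\<Sum>w\<in>words T s. card (B (arrivals s w T))) \<le> 2 * (2 ^ s) ^ T"
proof -
  \<comment> \<open>The letters whose children of \<open>take i w\<close> are retained at the end of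
    stage \<open>i\<close>. This set depends on \<open>take i w\<close> alone and, as siblings
    conflict, has at most one element.\<close>
  define D where "D w i = {a. a < 2 ^ s \<and> list_encode (take i w @ [a]) \<in> B (arrivals s w (Suc i))}"
    for w i
  have indep_i: "common_indep (matroids k T s) (B (arrivals s w i))" if "w \<in> words T s" "i \<le> T" for w i
    using indep[OF that(1), of "length (arrivals s w i)"] arrivals_eq_append[OF that(2), of s w]
    by simp
  have sub: "B (arrivals s w T) \<subseteq> B (arrivals s w i) \<union> set (concat (map (stage s w) [i..<T]))"
    if "w \<in> words T s" "i \<le> T" for w i
    using step that by (intro online_subset arrivals_eq_append) auto
  have card_le: "card (B (arrivals s w T)) \<le> 1 + card {i \<in> {..<T}. w ! i \<in> D w i}"
    if w: "w \<in> words T s" for w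
  proof -
    let ?F = "B (arrivals s w T)"
    have lenw: "length w = T"
      using w by (simp add: words_def)
    have F: "?F \<subseteq> set (arrivals s w T)"
      using sub[OF w, of 0] empty by (simp add: arrivals_def)
    then have fin: "finite ?F"
      by (rule finite_subset) simp
    have eq: "x = y" if x: "x \<in> ?F - hidden_path w" and y: "y \<in> ?F - hidden_path w" for x y
    proof -
      have decomp: "\<exists>i<T. \<exists>a. z = list_encode (take i w @ [a]) \<and> a \<noteq> w ! i"
        if z: "z \<in> ?F - hidden_path w" for z
      proof -
        obtain i a where ia: "i < T" "z = list_encode (take i w @ [a])"
          using z F by (auto simp: set_arrivals)
        moreover have "a \<noteq> w ! i"
          using z ia lenw by (auto simp: hidden_path_def take_Suc_conv_app_nth image_iff)
        ultimately show ?thesis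
          by blast
      qed
      obtain i a where i: "i < T" "x = list_encode (take i w @ [a])" "a \<noteq> w ! i"
        using decomp x by blast
      obtain j b where j: "j < T" "y = list_encode (take j w @ [b])" "b \<noteq> w ! j"
        using decomp y by blast
      note conflict = common_indep_siblings[OF k indep_i[OF w order_refl]]
      \<comment> \<open>A node kept from stage \<open>q\<close> extends \<open>take p w\<close> by
        \<open>w ! p\<close>, hence clashes with the child \<open>c \<noteq> w ! p\<close> kept from
        the earlier stage \<open>p\<close>.\<close>
      have no: False if "p < q" "q < T" "c \<noteq> w ! p" "list_encode (take p w @ [c]) \<in> ?F"
        "list_encode (take q w @ [d]) \<in> ?F" for p q c d
      proof -
        have "take q w = take p w @ w ! p # drop (Suc p) (take q w)"
          using that(1,2) lenw id_take_nth_drop[of p "take q w"] by simp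
        then have "list_encode (take p w @ w ! p # (drop (Suc p) (take q w) @ [d])) \<in> ?F"
          using that(5) by (metis append.assoc append_Cons)
        from conflict[OF that(4) this] that(3) show False
          by simp
      qed
      have "i = j"
        using no[of i j a b] no[of j i b a] i j x y by (metis DiffD1 linorder_neqE_nat)
      moreover have "a = b"
        using conflict[of "take i w" a b "[]"] i j x y \<open>i = j\<close> by simp
      ultimately show ?thesis
        using i j by simp
    qed
    have "card (?F - hidden_path w) \<le> 1"
      using fin eq by (auto simp: card_le_Suc0_iff_eq)
    moreover have "?F \<inter> hidden_path w \<subseteq> (\<lambda>i. list_encode (take (Suc i) w)) ` {i \<in> {..<T}. w ! i \<in> D w i}"
    proof
      fix z assume z: "z \<in> ?F \<inter> hidden_path w"
      then obtain i where i: "i < T" "z = list_encode (take (Suc i) w)"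
        using lenw by (auto simp: hidden_path_def)
      have z': "z = list_encode (take i w @ [w ! i])"
        using i lenw by (simp add: take_Suc_conv_app_nth)
      have wi: "w ! i < 2 ^ s"
        using w i by (auto simp: words_def subset_iff)
      have "z \<in> set (arrivals s w (Suc i))"
        using z' wi by (auto simp: set_arrivals)
      then have "z \<notin> set (concat (map (stage s w) [Suc i..<T]))"
        using distinct_arrivals[of T w s] lenw i arrivals_eq_append[of "Suc i" T s w] by auto
      then have "z \<in> B (arrivals s w (Suc i))"
        using sub[OF w, of "Suc i"] i z by auto
      then have "w ! i \<in> D w i"
        using z' wi by (simp add: D_def)
      with i show "z \<in> (\<lambda>i. list_encode (take (Suc i) w)) ` {i \<in> {..<T}. w ! i \<in> D w i}"
        by blast
    qed
    then have "card (?F \<inter> hidden_path w) \<le> card {i \<in> {..<T}. w ! i \<in> D w i}"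
      by (rule surj_card_le[rotated]) simp
    moreover have "card ?F = card (?F - hidden_path w) + card (?F \<inter> hidden_path w)"
      using fin by (simp add: card_Diff_subset_Int card_mono)
    ultimately show ?thesis
      by linarith
  qed
  have hit: "card {w \<in> words T s. w ! i \<in> D w i} * 2 ^ s \<le> (2 ^ s) ^ T" if "i < T" for i
  proof (rule card_words_hit[OF that])
    show "D w i = D w' i" if "take i w = take i w'" for w w'
      using that arrivals_cong[OF that, of s] by (simp add: D_def)
    show "a = b" if "w \<in> words T s" "a \<in> D w i" "b \<in> D w i" for w a b
      using common_indep_siblings[OF k indep_i[OF that(1), of "Suc i"], of "take i w" a b "[]"]
        that \<open>i < T\<close> by (auto simp: D_def)
  qed
  \<comment> \<open>Double counting of the pairs of a word and a level on which it is hit.\<close>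
  have "(\<Sum>w\<in>words T s. card {i \<in> {..<T}. w ! i \<in> D w i}) =
        (\<Sum>i<T. card {w \<in> words T s. w ! i \<in> D w i})"
    using finite_words by (intro sum_multicount_gen) auto
  also have "\<dots> * 2 ^ s \<le> T * (2 ^ s) ^ T"
    unfolding sum_distrib_right
    using sum_bounded_above[of "{..<T}" "\<lambda>i. card {w \<in> words T s. w ! i \<in> D w i} * 2 ^ s"
      "(2 ^ s) ^ T"] hit by simp
  \<comment> \<open>By \<open>T \<le> 2 ^ s\<close>, the average number of hits, at most
    \<open>T / 2 ^ s\<close>, is at most 1.\<close>
  also have "\<dots> \<le> (2 ^ s) ^ T * 2 ^ s"
    using T by simp
  finally have "(\<Sum>w\<in>words T s. card {i \<in> {..<T}. w ! i \<in> D w i}) \<le> (2 ^ s) ^ T"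
    by simp
  moreover have "(\<Sum>w\<in>words T s. card (B (arrivals s w T))) \<le>
      (\<Sum>w\<in>words T s. 1 + card {i \<in> {..<T}. w ! i \<in> D w i})"
    by (intro sum_mono card_le)
  ultimately show ?thesis
    unfolding sum.distrib by (simp add: card_words)
qed

section \<open>From deterministic to randomized algorithms\<close>

lemma online_algorithmD:
  assumes "online_algorithm C A" and "C U Is f xs"
  shows "A U Is f [] = {}"
    and "\<forall>n<length xs. A U Is f (take (Suc n) xs) \<subseteq> insert (xs ! n) (A U Is f (take n xs))"
    and "\<forall>n\<le>length xs. common_indep Is (A U Is f (take n xs))"
  using assms(1)[unfolded online_algorithm_def, THEN conjunct1,
    THEN spec, THEN spec, THEN spec, THEN spec, THEN mp, OF assms(2)] by simp_all

text \<open>Yao's principle: the ratio holds for every hidden word, hence on average, and exchanging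
  the finite sum with the expectation leaves deterministic averages, at most \<open>N\<close>. A
  general class \<open>C\<close> allows both classes of the theorem to be treated at once.\<close>

lemma competitive_ge_average:
  fixes C :: "nat inst_class"
  assumes k: "4 * T * s < k" and "T \<le> r"
    and C: "\<And>U Is f xs. card_partition_instance k r U Is f xs \<Longrightarrow> C U Is f xs"
    and M: "randomized_online_algorithm C M" and "competitive C M c" and "0 < c"
    and avg: "\<And>A. A \<in> space M \<Longrightarrow>
      (\<Sum>w\<in>words T s. card (A (universe T s) (matroids k T s) (\<lambda>S. real (card S)) (arrivals s w T)))
        \<le> N * (2 ^ s) ^ T"
  shows "real T \<le> real N * c"
proof -
  interpret prob_space M
    using M by (simp add: randomized_online_algorithm_def)
  let ?f = "\<lambda>S :: nat set. real (card S)"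
  define X where "X w A = ?f (A (universe T s) (matroids k T s) ?f (arrivals s w T))" for w A
  have inst: "C (universe T s) (matroids k T s) ?f (arrivals s w T)" if "w \<in> words T s" for w
    using C arrivals_instance[OF k \<open>T \<le> r\<close> that] by blast
  \<comment> \<open>A crude bound, one summand against the whole sum, for the sake of
    integrability.\<close>
  have X_le: "X w A \<le> real (N * (2 ^ s) ^ T)" if "w \<in> words T s" "A \<in> space M" for w A
  proof -
    have "card (A (universe T s) (matroids k T s) ?f (arrivals s w T)) \<le> N * (2 ^ s) ^ T"
      using member_le_sum[OF that(1), of "\<lambda>w. card (A (universe T s) (matroids k T s) ?f (arrivals s w T))"]
        finite_words avg[OF that(2)] by (meson le_trans zero_le)
    then show ?thesis
      unfolding X_def by (rule of_nat_mono)
  qed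
  have int: "integrable M (X w)" if w: "w \<in> words T s" for w
  proof (rule integrable_const_bound)
    have "(\<lambda>A. A (universe T s) (matroids k T s) ?f (arrivals s w T)) \<in> measurable M (count_space UNIV)"
      using M inst[OF w] by (auto simp: randomized_online_algorithm_def)
    then show "X w \<in> borel_measurable M"
      unfolding X_def by (rule measurable_compose) simp
    show "AE A in M. norm (X w A) \<le> real (N * (2 ^ s) ^ T)"
      using X_le[OF w] by (intro AE_I2) (simp add: X_def)
  qed
  have lower: "real T / c \<le> expectation (X w)" if w: "w \<in> words T s" for w
  proof -
    have "real T / c \<le> 1 / c * opt_value (matroids k T s) ?f (arrivals s w T)"
      using opt_value_arrivals[OF k w] \<open>0 < c\<close> by (simp add: divide_right_mono)
    also have "\<dots> \<le> expectation (X w)"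
      using \<open>competitive C M c\<close> inst[OF w] unfolding competitive_def X_def by blast
    finally show ?thesis .
  qed
  have "real ((2 ^ s) ^ T) * (real T / c) = (\<Sum>w\<in>words T s. real T / c)"
    by (simp add: card_words)
  also have "\<dots> \<le> (\<Sum>w\<in>words T s. expectation (X w))"
    by (intro sum_mono lower)
  also have "\<dots> = expectation (\<lambda>A. \<Sum>w\<in>words T s. X w A)"
    using int by simp
  also have "\<dots> \<le> real (N * (2 ^ s) ^ T)"
  proof (rule integral_le_const)
    show "integrable M (\<lambda>A. \<Sum>w\<in>words T s. X w A)"
      using int by simp
    have "(\<Sum>w\<in>words T s. X w A) \<le> real (N * (2 ^ s) ^ T)" if "A \<in> space M" for A
      using of_nat_mono[OF avg[OF that], where ?'a = real] by (simp add: X_def)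
    then show "AE A in M. (\<Sum>w\<in>words T s. X w A) \<le> real (N * (2 ^ s) ^ T)"
      by (intro AE_I2)
  qed
  finally have "real ((2 ^ s) ^ T) * (real T / c) \<le> real ((2 ^ s) ^ T) * real N"
    by (simp only: of_nat_mult mult.commute)
  then have "real T / c \<le> real N"
    by (subst (asm) mult_le_cancel_left_pos) simp_all
  then show ?thesis
    using \<open>0 < c\<close> by (simp add: divide_le_eq)
qed

lemma competitive_ge_half:
  fixes C :: "nat inst_class"
  assumes k: "4 * T * s < k" and "T \<le> r" and T: "T \<le> 2 ^ s"
    and C: "\<And>U Is f xs. card_partition_instance k r U Is f xs \<Longrightarrow> C U Is f xs"
    and M: "randomized_online_algorithm C M" and "competitive C M c" and "0 < c"
  shows "real T \<le> 2 * c"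
proof -
  let ?f = "\<lambda>S :: nat set. real (card S)"
  have avg: "(\<Sum>w\<in>words T s. card (A (universe T s) (matroids k T s) ?f (arrivals s w T)))
      \<le> 2 * (2 ^ s) ^ T" if "A \<in> space M" for A
  proof (rule sum_card_solutions[OF k T])
    have alg: "online_algorithm C A"
      using M that by (simp add: randomized_online_algorithm_def)
    have inst: "C (universe T s) (matroids k T s) ?f (arrivals s w T)" if "w \<in> words T s" for w
      using C arrivals_instance[OF k \<open>T \<le> r\<close> that] by blast
    note D = online_algorithmD[OF alg inst]
    \<comment> \<open>Any word gives an instance from which the empty initial solution can be read
      off.\<close>
    have "replicate T 0 \<in> words T s"
      by (auto simp: words_def)
    then show "A (universe T s) (matroids k T s) ?f [] = {}"
      by (rule D(1))
    show "A (universe T s) (matroids k T s) ?f (take (Suc n) (arrivals s w T)) \<subseteq>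
        insert (arrivals s w T ! n) (A (universe T s) (matroids k T s) ?f (take n (arrivals s w T)))"
      if "w \<in> words T s" "n < length (arrivals s w T)" for w n
      using D(2)[OF that(1)] that(2) by blast
    show "common_indep (matroids k T s) (A (universe T s) (matroids k T s) ?f (take n (arrivals s w T)))"
      if "w \<in> words T s" "n \<le> length (arrivals s w T)" for w n
      using D(3)[OF that(1)] that(2) by blast
  qed
  have "real T \<le> real 2 * c"
    by (rule competitive_ge_average[OF k \<open>T \<le> r\<close> C M \<open>competitive C M c\<close> \<open>0 < c\<close>]) (assumption, rule avg, assumption)
  then show ?thesis
    by simp
qed

text \<open>For \<open>T = 1\<close> and \<open>s = 0\<close> the alphabet has one letter, so a
  single element arrives and \<open>N = 1\<close> bounds every solution.\<close>

lemma competitive_ge_1: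
  fixes C :: "nat inst_class"
  assumes k: "0 < k" and "1 \<le> r"
    and C: "\<And>U Is f xs. card_partition_instance k r U Is f xs \<Longrightarrow> C U Is f xs"
    and M: "randomized_online_algorithm C M" and "competitive C M c" and "0 < c"
  shows "1 \<le> c"
proof -
  let ?f = "\<lambda>S :: nat set. real (card S)"
  have k': "4 * 1 * 0 < k"
    using k by simp
  have avg: "(\<Sum>w\<in>words 1 0. card (A (universe 1 0) (matroids k 1 0) ?f (arrivals 0 w 1)))
      \<le> 1 * (2 ^ 0) ^ 1" if A: "A \<in> space M" for A
  proof -
    have "card (A (universe 1 0) (matroids k 1 0) ?f (arrivals 0 w 1)) \<le> 1" if w: "w \<in> words 1 0" for w
    proof -
      let ?B = "A (universe 1 0) (matroids k 1 0) ?f"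
      have alg: "online_algorithm C A"
        using M A by (simp add: randomized_online_algorithm_def)
      have inst: "C (universe 1 0) (matroids k 1 0) ?f (arrivals 0 w 1)"
        using C arrivals_instance[OF k' \<open>1 \<le> r\<close> w] by blast
      have "?B (arrivals 0 w 1) \<subseteq> ?B [] \<union> set (arrivals 0 w 1)"
        by (rule online_subset[OF online_algorithmD(2)[OF alg inst]]) simp
      then have "card (?B (arrivals 0 w 1)) \<le> card (set (arrivals 0 w 1))"
        unfolding online_algorithmD(1)[OF alg inst] by (intro card_mono) auto
      also have "\<dots> \<le> length (arrivals 0 w 1)"
        by (rule card_length)
      also have "\<dots> = 1"
        by (simp add: arrivals_def stage_def)
      finally show ?thesis .
    qed
    then have "(\<Sum>w\<in>words 1 0. card (A (universe 1 0) (matroids k 1 0) ?f (arrivals 0 w 1)))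
        \<le> of_nat (card (words 1 0)) * 1"
      by (rule sum_bounded_above)
    then show ?thesis
      by (simp add: card_words)
  qed
  have "real 1 \<le> real 1 * c"
    by (rule competitive_ge_average[OF k' \<open>1 \<le> r\<close> C M \<open>competitive C M c\<close> \<open>0 < c\<close>]) (assumption, rule avg, assumption)
  then show ?thesis
    by simp
qed

section \<open>Choice of the parameters\<close>

lemma competitive_ratio_ge:
  fixes C :: "nat inst_class"
  assumes k: "2 \<le> k"
    and C: "\<And>U Is f xs. card_partition_instance k (nat \<lceil>k / ln k\<rceil>) U Is f xs \<Longrightarrow> C U Is f xs"
    and M: "randomized_online_algorithm C M"
  shows "ereal (real k / (81 * ln (real k))) \<le> competitive_ratio C M"
  unfolding competitive_ratio_def
proof (rule Inf_greatest, clarify)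
  fix c :: real
  assume c: "0 < c" "competitive C M c"
  let ?r = "nat \<lceil>k / ln k\<rceil>"
  have ln_pos: "0 < ln (real k)"
    using k by simp
  have "real k / (81 * ln (real k)) \<le> c"
  proof (cases "real k / ln (real k) \<le> 81")
    case True
    have "0 < real k / ln (real k)"
      using k ln_pos by simp
    then have "1 \<le> ?r"
      by linarith
    then have "1 \<le> c"
      using k c by (intro competitive_ge_1[OF _ _ C M]) auto
    with True have "real k / ln (real k) \<le> 81 * c"
      by linarith
    then show ?thesis
      by simp
  next
    case False
    have big: "81 * ln (real k) < real k"
      using False ln_pos by (simp add: field_simps)
    have "ln 2 \<le> ln (real k)"
      using k by simp
    \<comment> \<open>Indeed \<open>81 * 2 / 3 = 54 < k\<close>; the value 3 is an upper bound for
      \<open>exp 1\<close>.\<close>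
    then have "3 \<le> real k"
      using big ln2_ge_two_thirds by linarith
    then have ln_ge_1: "1 \<le> ln (real k)"
      using exp_le by (subst ln_ge_iff) auto
    define s where "s = nat \<lceil>log 2 k\<rceil>"
    \<comment> \<open>The largest \<open>T\<close> with \<open>4 * T * s < k\<close>, whence the
      \<open>k - 1\<close>.\<close>
    define T where "T = (k - 1) div (4 * s)"
    have log_ge: "ln k \<le> log 2 k"
      using ln_pos ln_2_less_1 by (simp add: log_def le_divide_eq)
    have log_le: "log 2 k \<le> 3 / 2 * ln k"
      using mult_right_mono[OF ln2_ge_two_thirds, of "3 / 2 * ln (real k)"] ln_pos
      by (simp add: log_def divide_le_eq mult.commute)
    \<comment> \<open>Rounding up costs at most \<open>1 \<le> ln k\<close>, and
      \<open>3 / 2 + 1 = 5 / 2\<close>.\<close>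
    have s: "log 2 k \<le> s" "real s \<le> 5 / 2 * ln k"
      using log_ge log_le ln_ge_1 unfolding s_def by linarith+
    have s_pos: "0 < s"
      using s log_ge ln_ge_1 by linarith
    have "real k = 2 powr (log 2 k)"
      using k by simp
    also have "\<dots> \<le> 2 powr s"
      using s by simp
    finally have "k \<le> 2 ^ s"
      by (simp add: powr_realpow)
    moreover have "T \<le> k"
      unfolding T_def by (meson diff_le_self div_le_dividend le_trans)
    ultimately have T_le: "T \<le> 2 ^ s"
      by linarith
    have "4 * T * s \<le> k - 1"
      unfolding T_def using div_times_less_eq_dividend[of "k - 1" "4 * s"] by (simp add: ac_simps)
    then have k_gt: "4 * T * s < k"
      using k by linarith
    then have "real (4 * T * s) \<le> real k"
      by (intro of_nat_mono) simp
    then have "real T * (4 * real s) \<le> real k"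
      by (simp add: ac_simps)
    \<comment> \<open>Since \<open>ln k \<le> log 2 k \<le> s\<close>, the depth \<open>T\<close>
      stays within the allowed common rank.\<close>
    moreover have "real T * ln k \<le> real T * (4 * real s)"
      using s log_ge by (intro mult_left_mono) auto
    ultimately have "real T \<le> k / ln k"
      using ln_pos by (simp add: le_divide_eq)
    then have "T \<le> ?r"
      by linarith
    then have "real T \<le> 2 * c"
      using c by (intro competitive_ge_half[OF k_gt _ T_le C M]) auto
    \<comment> \<open>The maximality of \<open>T\<close> turns \<open>T \<le> 2 * c\<close> into an
      upper bound on \<open>k\<close>.\<close>
    have "k - 1 < (T + 1) * (4 * s)"
      unfolding T_def using s_pos dividend_less_div_times[of "4 * s" "k - 1"] by simp
    then have "k \<le> (T + 1) * (4 * s)"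
      by linarith
    then have "real k \<le> (real T + 1) * (4 * real s)"
      by (metis (mono_tags) of_nat_1 of_nat_add of_nat_le_iff of_nat_mult of_nat_numeral)
    also have "\<dots> \<le> (2 * c + 1) * (10 * ln k)"
      by (rule mult_mono) (use s \<open>real T \<le> 2 * c\<close> c in auto)
    finally have "real k / ln k \<le> 20 * c + 10"
      using ln_pos by (simp add: field_simps)
    \<comment> \<open>For \<open>x = k / ln k > 81\<close>, the bound
      \<open>(x - 10) / 20 \<le> c\<close> yields \<open>x / 81 \<le> c\<close>, because
      \<open>810 \<le> 61 * x\<close>.\<close>
    then show ?thesis
      using False by simp
  qed
  then show "ereal (real k / (81 * ln (real k))) \<le> ereal c"
    by simp
qed

theorem theorem4p1:
  shows "(\<forall>k\<ge>2. \<forall>M :: nat online_alg measure.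
            randomized_online_algorithm (smkm_instance k) M \<longrightarrow>
            ereal (real k / (81 * ln (real k))) \<le> competitive_ratio (smkm_instance k) M)
       \<and> (\<exists>r :: nat \<Rightarrow> nat.
            (\<lambda>k. real (r k)) \<in> O(\<lambda>k. real k / ln (real k)) \<and>
            (\<forall>k\<ge>2. \<forall>M :: nat online_alg measure.
               randomized_online_algorithm (card_partition_instance k (r k)) M \<longrightarrow>
               ereal (real k / (81 * ln (real k)))
                 \<le> competitive_ratio (card_partition_instance k (r k)) M))"
\<comment> \<open>This rank bound exceeds the depth of the tree and is at least 1, as the
  single-element instance requires.\<close>
proof (intro conjI allI impI exI[of _ "\<lambda>k. nat \<lceil>real k / ln (real k)\<rceil>"])
  show "(\<lambda>k. real (nat \<lceil>real k / ln (real k)\<rceil>)) \<in> O(\<lambda>k. real k / ln (real k))"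
  proof (rule bigoI[where c = 2])
    have "norm (real (nat \<lceil>real k / ln (real k)\<rceil>)) \<le> 2 * norm (real k / ln (real k))"
      if "2 \<le> k" for k
    proof -
      have "0 < ln (real k)" "ln (real k) \<le> real k"
        using that ln_le_minus_one[of "real k"] by auto
      \<comment> \<open>For \<open>x \<ge> 1\<close> the ceiling is at most
        \<open>x + 1 \<le> 2 * x\<close>.\<close>
      then have "1 \<le> real k / ln (real k)"
        by simp
      then show ?thesis
        unfolding real_norm_def by linarith
    qed
    then show "\<forall>\<^sub>F k in sequentially. norm (real (nat \<lceil>real k / ln (real k)\<rceil>))
        \<le> 2 * norm (real k / ln (real k))"
      by (rule eventually_sequentiallyI)
  qed
next
  fix k :: nat and M :: "nat online_alg measure"
  assume "2 \<le> k" and M: "randomized_online_algorithm (smkm_instance k) M"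
  from this(1) show "ereal (real k / (81 * ln (real k))) \<le> competitive_ratio (smkm_instance k) M"
    by (rule competitive_ratio_ge[OF _ _ M]) (simp add: card_partition_instance_def)
next
  fix k :: nat and M :: "nat online_alg measure"
  assume k: "2 \<le> k"
    and M: "randomized_online_algorithm (card_partition_instance k (nat \<lceil>real k / ln (real k)\<rceil>)) M"
  from k show "ereal (real k / (81 * ln (real k)))
      \<le> competitive_ratio (card_partition_instance k (nat \<lceil>real k / ln (real k)\<rceil>)) M"
    by (rule competitive_ratio_ge[OF _ _ M])
qed

end
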